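(* Assume the generalized continuum hypothesis. Let $k$ be an infinite cardinal and let $(X,G)$ be a space with a transformation group such that $\operatorname{card}(X)=k^{+}$ and $G$ acts freely and transitively on $X$. Let $\mathcal S$ be a diffused, $k$-additive algebra on $(X,G)$ which is admissible with respect to a $k$-small system $\{\mathcal N_\alpha\}_{0\le\alpha<k}$ on $(X,G)$. Let $\mathcal N_\infty=\bigcap_{0\le\alpha<k}\mathcal N_\alpha$ and let $\widetilde{\mathcal S}$ be the $k$-additive algebra on $(X,G)$ generated by $\mathcal S$ and $\mathcal N_\infty$. Then the $k$-additive measurable structure $(\widetilde{\mathcal S},\mathcal N_\infty)$ can be extended to a $k$-additive measurable structure $(\widetilde{\widetilde{\mathcal S}},\mathcal N_\infty)$ on $(X,G)$ (so $\widetilde{\mathcal S}\subseteq\widetilde{\widetilde{\mathcal S}}$) for which there exist an ordinal $\alpha_0<k$ and a strictly $k$-independent family $\{A_i : i\in I\}$ of sets from $\widetilde{\widetilde{\mathcal S}}$ with $\operatorname{card}(I)=2^{k^{+}}$, where $\widetilde{\widetilde{\mathcal S}}$ is the $k$-additive algebra on $(X,G)$ generated by $\widetilde{\mathcal S}$ and $\{A_i : i\in I\}$, such that the sets $$U_\alpha=\{(E,F)\in\widetilde{\widetilde{\mathcal S}}\times\widetilde{\widetilde{\mathcal S}} : E\,\Delta\,F\in\mathcal N_\alpha\}\qquad(0\le\alpha<k)$$ form a base $\mathcal V=\{U_\alpha\}_{0\le\alpha<k}$ of some uniformity on $\widetilde{\widetilde{\mathcal S}}$, and $(A_i,A_j)\notin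 U_{\alpha_0}$ whenever $i,j\in I$, $i\ne j$.
   Context: We work in ZFC. Every infinite cardinal is identified with the least ordinal representing it, and $k^{+}$ is the successor cardinal of $k$. A space with a transformation group is a pair $(X,G)$ where $X$ is a nonempty set and $G$ is a subgroup of the group of all bijections of $X$. For $g\in G$, $E\subseteq X$, put $gE=\{gx:x\in E\}$. $G$ acts freely if $\{x\in X:gx=x\}=\emptyset$ for every non-identity $g\in G$; $G$ acts transitively if $Gx=\{gx:g\in G\}=X$ for every $x\in X$. A nonempty class $\mathcal A$ of subsets of $X$ is $G$-invariant if $gE\in\mathcal A$ for all $g\in G$, $E\in\mathcal A$. A class of sets is $k$-additive if it is closed under unions of at most $k$ of its members. A $k$-additive algebra (resp. ideal) on $(X,G)$ is an algebra (resp. ideal) of subsets of $X$ that is $k$-additive and $G$-invariant. The $k$-additive algebra on $(X,G)$ generated by given classes is the smallest such algebra containing them. A $k$-additive measurable structure on $(X,G)$ is a pair $(\mathcal S,\mathfrak I)$ where $\mathcal S$ is a $k$-additive algebra on $(X,G)$ and $\mathfrak I\subseteq\mathcal S$ is a proper $k$-additive ideal on $(X,G)$. An algebra on $X$ is diffused if it contains all singletons $\{x\}$, $x\in X$. A $k$-small system on $(X,G)$ is a transfinite sequence $\{\mathcal N_\alpha\}_{0\le\alpha<k}$ of classes of subsets of $X$ such that: (i) $\emptyset\in\mathcal N_\alpha$ for all $\alpha<k$; (ii) each $\mathcal N_\alpha$ is $G$-invariant; (iii) if $E\in\mathcal N_\alpha$ and $F\subseteq E$ then $F\in\mathcal N_\alpha$;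 (iv) if $E\in\mathcal N_\alpha$ and $F\in\bigcap_{0\le\beta<k}\mathcal N_\beta$ then $E\cup F\in\mathcal N_\alpha$; (v) for any $\alpha<k$ there is $\alpha^{*}$ with $\alpha<\alpha^{*}<k$ such that for any one-to-one correspondence $\beta\mapsto\mathcal N_\beta$ with $\beta>\alpha^{*}$, $\bigcup_\beta E_\beta\in\mathcal N_\alpha$ whenever $E_\beta\in\mathcal N_\beta$ (that is, a union of sets $E_\beta\in\mathcal N_\beta$, one for each index $\beta$ with $\alpha^{*}<\beta<k$, belongs to $\mathcal N_\alpha$); (vi) for any $\alpha,\beta<k$ there is $\gamma<k$ with $\gamma>\alpha,\beta$ such that $\mathcal N_\gamma\subseteq\mathcal N_\alpha$ and $\mathcal N_\gamma\subseteq\mathcal N_\beta$. A $k$-additive algebra $\mathcal S$ on $(X,G)$ is admissible with respect to $\{\mathcal N_\alpha\}_{0\le\alpha<k}$ if: (i) $\mathcal S\setminus\mathcal N_\alpha\ne\emptyset$ for some $\alpha<k$ and $\mathcal S\cap\mathcal N_\alpha\neq\emptyset$ for every $\alpha<k$; (ii) for each $\alpha<k$, every $E\in\mathcal N_\alpha$ is contained in some $F\in\mathcal N_\alpha\cap\mathcal S$; (iii) for each $\alpha<k$, every collection of mutually disjoint sets from $\mathcal S\setminus\mathcal N_\alpha$ has cardinality at most $k$. With these definitions $\mathcal N_\infty$ is a $k$-additive ideal on $(X,G)$, each element of $\widetilde{\mathcal S}$ has the form $(A\setminus Y)\cup Z$ with $A\in\mathcal S$ and $Y,Z\in\mathcal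 N_\infty$, and $(\widetilde{\mathcal S},\mathcal N_\infty)$ is a $k$-additive measurable structure on $(X,G)$. A family $\{A_i:i\in I\}$ of subsets of $X$ is strictly $k$-independent if for every $J\subseteq I$ with $\operatorname{card}J\le k$ and every $f:J\to\{0,1\}$ we have $\bigcap_{j\in J}A_j^{f(j)}\neq\emptyset$, where $A_j^{0}=A_j$ and $A_j^{1}=X\setminus A_j$. *)

theory Defs
  imports "HOL-Analysis.Sigma_Algebra" "HOL-Algebra.Bij" "HOL.Hull"
begin

unbundle cardinal_syntax

text \<open>
  An infinite cardinal \<open>k\<close> is a relation with \<^prop>\<open>Cinfinite k\<close>: a well-order of minimal type on an
  infinite field. The ordinals below \<open>k\<close> are the elements of \<^term>\<open>Field k\<close>, and
  \<^term>\<open>aboveS k \<alpha>\<close> is the set of ordinals \<open>\<beta>\<close> with \<open>\<alpha> < \<beta> < k\<close>.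
\<close>

text \<open>
  A HOL formula cannot quantify over all types, so GCH is stated for the infinite cardinals that are
  realised by sets over a given type.
\<close>

definition GCH :: "'a itself \<Rightarrow> bool" where
  "GCH (_ :: 'a itself) \<longleftrightarrow> (\<forall>A :: 'a set. infinite A \<longrightarrow> |Pow A| =o cardSuc |A| )"

definition transformation_space :: "'a set \<Rightarrow> ('a \<Rightarrow> 'a) set \<Rightarrow> bool" where
  "transformation_space X G \<longleftrightarrow> X \<noteq> {} \<and> subgroup G (BijGroup X)"

definition acts_freely :: "'a set \<Rightarrow> ('a \<Rightarrow> 'a) set \<Rightarrow> bool" where
  "acts_freely X G \<longleftrightarrow> (\<forall>g\<in>G. g \<noteq> \<one>\<^bsub>BijGroup X\<^esub> \<longrightarrow> {x \<in> X. g x = x} = {})"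

definition acts_transitively :: "'a set \<Rightarrow> ('a \<Rightarrow> 'a) set \<Rightarrow> bool" where
  "acts_transitively X G \<longleftrightarrow> (\<forall>x\<in>X. {g x | g. g \<in> G} = X)"

definition invariant_class :: "'a set \<Rightarrow> ('a \<Rightarrow> 'a) set \<Rightarrow> 'a set set \<Rightarrow> bool" where
  "invariant_class X G \<A> \<longleftrightarrow> \<A> \<noteq> {} \<and> \<A> \<subseteq> Pow X \<and> (\<forall>g\<in>G. \<forall>E\<in>\<A>. g ` E \<in> \<A>)"

definition k_additive :: "'k rel \<Rightarrow> 'a set set \<Rightarrow> bool" where
  "k_additive k \<A> \<longleftrightarrow> (\<forall>\<C>. \<C> \<subseteq> \<A> \<and> |\<C>| \<le>o k \<longrightarrow> \<Union>\<C> \<in> \<A>)"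

definition set_ideal :: "'a set \<Rightarrow> 'a set set \<Rightarrow> bool" where
  "set_ideal X \<I> \<longleftrightarrow> \<I> \<noteq> {} \<and> \<I> \<subseteq> Pow X \<and>
     (\<forall>E\<in>\<I>. \<forall>F. F \<subseteq> E \<longrightarrow> F \<in> \<I>) \<and> (\<forall>E\<in>\<I>. \<forall>F\<in>\<I>. E \<union> F \<in> \<I>)"

definition k_algebra :: "'k rel \<Rightarrow> 'a set \<Rightarrow> ('a \<Rightarrow> 'a) set \<Rightarrow> 'a set set \<Rightarrow> bool" where
  "k_algebra k X G \<S> \<longleftrightarrow> algebra X \<S> \<and> k_additive k \<S> \<and> invariant_class X G \<S>"

definition k_ideal :: "'k rel \<Rightarrow> 'a set \<Rightarrow> ('a \<Rightarrow> 'a) set \<Rightarrow> 'a set set \<Rightarrow> bool" where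
  "k_ideal k X G \<I> \<longleftrightarrow> set_ideal X \<I> \<and> k_additive k \<I> \<and> invariant_class X G \<I>"

definition measurable_structure ::
    "'k rel \<Rightarrow> 'a set \<Rightarrow> ('a \<Rightarrow> 'a) set \<Rightarrow> 'a set set \<Rightarrow> 'a set set \<Rightarrow> bool" where
  "measurable_structure k X G \<S> \<I> \<longleftrightarrow>
     k_algebra k X G \<S> \<and> k_ideal k X G \<I> \<and> X \<notin> \<I> \<and> \<I> \<subseteq> \<S>"

definition diffused :: "'a set \<Rightarrow> 'a set set \<Rightarrow> bool" where
  "diffused X \<S> \<longleftrightarrow> (\<forall>x\<in>X. {x} \<in> \<S>)"

definition N_infinity :: "'k rel \<Rightarrow> ('k \<Rightarrow> 'a set set) \<Rightarrow> 'a set set" where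
  "N_infinity k N = (\<Inter>\<alpha>\<in>Field k. N \<alpha>)"

definition small_system ::
    "'k rel \<Rightarrow> 'a set \<Rightarrow> ('a \<Rightarrow> 'a) set \<Rightarrow> ('k \<Rightarrow> 'a set set) \<Rightarrow> bool" where
  "small_system k X G N \<longleftrightarrow>
     (\<forall>\<alpha>\<in>Field k. {} \<in> N \<alpha>) \<and>
     (\<forall>\<alpha>\<in>Field k. invariant_class X G (N \<alpha>)) \<and>
     (\<forall>\<alpha>\<in>Field k. \<forall>E\<in>N \<alpha>. \<forall>F. F \<subseteq> E \<longrightarrow> F \<in> N \<alpha>) \<and>
     (\<forall>\<alpha>\<in>Field k. \<forall>E\<in>N \<alpha>. \<forall>F\<in>N_infinity k N. E \<union> F \<in> N \<alpha>) \<and>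
     (\<forall>\<alpha>\<in>Field k. \<exists>\<alpha>'\<in>aboveS k \<alpha>. \<forall>E. (\<forall>\<beta>\<in>aboveS k \<alpha>'. E \<beta> \<in> N \<beta>) \<longrightarrow>
        (\<Union>\<beta>\<in>aboveS k \<alpha>'. E \<beta>) \<in> N \<alpha>) \<and>
     (\<forall>\<alpha>\<in>Field k. \<forall>\<beta>\<in>Field k. \<exists>\<gamma>\<in>aboveS k \<alpha> \<inter> aboveS k \<beta>. N \<gamma> \<subseteq> N \<alpha> \<and> N \<gamma> \<subseteq> N \<beta>)"

definition admissible :: "'k rel \<Rightarrow> 'a set set \<Rightarrow> ('k \<Rightarrow> 'a set set) \<Rightarrow> bool" where
  "admissible k \<S> N \<longleftrightarrow>
     (\<exists>\<alpha>\<in>Field k. \<S> - N \<alpha> \<noteq> {}) \<and> (\<forall>\<alpha>\<in>Field k. \<S> \<inter> N \<alpha> \<noteq> {}) \<and>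
     (\<forall>\<alpha>\<in>Field k. \<forall>E\<in>N \<alpha>. \<exists>F\<in>N \<alpha> \<inter> \<S>. E \<subseteq> F) \<and>
     (\<forall>\<alpha>\<in>Field k. \<forall>\<C>. \<C> \<subseteq> \<S> - N \<alpha> \<and> disjoint \<C> \<longrightarrow> |\<C>| \<le>o k)"

text \<open>The intersection is taken inside \<open>X\<close>, so that \<open>J = {}\<close> yields \<open>X\<close>; \<open>f j\<close> marks complementation.\<close>

definition strictly_k_independent :: "'k rel \<Rightarrow> 'a set \<Rightarrow> 'i set \<Rightarrow> ('i \<Rightarrow> 'a set) \<Rightarrow> bool" where
  "strictly_k_independent k X I A \<longleftrightarrow> (\<forall>i\<in>I. A i \<subseteq> X) \<and>
     (\<forall>J (f :: 'i \<Rightarrow> bool). J \<subseteq> I \<and> |J| \<le>o k \<longrightarrow>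
        X \<inter> (\<Inter>j\<in>J. if f j then X - A j else A j) \<noteq> {})"

text \<open>
  The library's uniform spaces are a type class whose points form a whole type; here the points are
  the elements of a set \<open>Y\<close>, so uniformities are given by their entourages.
\<close>

definition is_uniformity :: "'y set \<Rightarrow> ('y \<times> 'y) set set \<Rightarrow> bool" where
  "is_uniformity Y \<U> \<longleftrightarrow>
     \<U> \<noteq> {} \<and> (\<forall>U\<in>\<U>. Id_on Y \<subseteq> U \<and> U \<subseteq> Y \<times> Y) \<and>
     (\<forall>U\<in>\<U>. \<forall>V. U \<subseteq> V \<and> V \<subseteq> Y \<times> Y \<longrightarrow> V \<in> \<U>) \<and>
     (\<forall>U\<in>\<U>. \<forall>V\<in>\<U>. U \<inter> V \<in> \<U>) \<and>
     (\<forall>U\<in>\<U>. U\<inverse> \<in> \<U>) \<and>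
     (\<forall>U\<in>\<U>. \<exists>V\<in>\<U>. V O V \<subseteq> U)"

definition uniformity_base :: "('y \<times> 'y) set set \<Rightarrow> ('y \<times> 'y) set set \<Rightarrow> bool" where
  "uniformity_base \<V> \<U> \<longleftrightarrow> \<V> \<subseteq> \<U> \<and> (\<forall>U\<in>\<U>. \<exists>V\<in>\<V>. V \<subseteq> U)"

definition entourage ::
    "'a set set \<Rightarrow> ('k \<Rightarrow> 'a set set) \<Rightarrow> 'k \<Rightarrow> ('a set \<times> 'a set) set" where
  "entourage \<S> N \<alpha> = {(E, F). E \<in> \<S> \<and> F \<in> \<S> \<and> sym_diff E F \<in> N \<alpha>}"

end

theory Submission
  imports Defs
begin

text \<open>
  Since at most \<open>k\<close> disjoint sets of \<open>\<S>\<close> lie outside \<open>\<N>\<^sub>\<alpha>\<close>, homogeneity puts all singletons, and hence all sets of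
  size \<open>k\<close>, into the \<open>k\<close>-additive ideal \<open>\<N>\<^sub>\<infinity>\<close>. For each \<open>\<eta> \<in> X\<close> some entry in the \<open>\<eta>\<close>-th column of
  an Ulam matrix on \<open>X\<close> is therefore outside \<open>\<N>\<^sub>\<infinity>\<close>; as there are only \<open>k\<close> rows and \<open>k\<close> classes
  \<open>\<N>\<^sub>\<alpha>\<close>, the pigeonhole principle yields one \<open>\<alpha>\<^sub>0\<close> and \<open>k\<^sup>+\<close> disjoint sets outside \<open>\<N>\<^bsub>\<alpha>\<^sub>0\<^esub>\<close>. GCH gives
  a Hausdorff independent family of \<open>2\<^bsup>k\<^sup>+\<^esup>\<close> subsets of an index set of size \<open>k\<^sup>+\<close>; blowing
  up each index to one of the disjoint sets produces the \<open>A\<^sub>i\<close>. Adjoining them costs nothing, because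
  the ideal is not enlarged, and axiom (v) of small systems halves entourages over any family of sets.
\<close>

section \<open>Cardinal arithmetic\<close>

lemma ordLeq_if_ordLess_cardSuc:
  assumes "Cinfinite k" "|Y| =o cardSuc k" "|A| <o |Y|"
  shows "|A| \<le>o k"
  using assms by (meson cardSuc_ordLeq_ordLess card_of_Card_order ordLess_ordIso_trans)

lemma not_ordLeq_if_ordIso_cardSuc:
  assumes "Cinfinite k" "|Y| =o cardSuc k"
  shows "\<not> |Y| \<le>o k"
proof
  assume "|Y| \<le>o k"
  then have "cardSuc k \<le>o k"
    using assms(2) ordIso_ordLeq_trans ordIso_symmetric by blast
  then show False
    using assms(1) cardSuc_greater not_ordLess_ordLeq by blast
qed

lemma ordLeq_if_not_ordLeq_cardSuc:
  assumes "Cinfinite k" "|Y| =o cardSuc k" "\<not> |A| \<le>o k"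
  shows "|Y| \<le>o |A|"
  using assms by (meson ordLeq_if_ordLess_cardSuc not_ordLeq_iff_ordLess card_of_Well_order)

lemma card_of_Pow_cong:
  assumes "|A| =o |B|"
  shows "|Pow A| =o |Pow B|"
  using assms unfolding card_of_ordIso[symmetric] by (blast intro: bij_betw_Pow)

lemma ordLeq_card_Field_iff:
  assumes "Cinfinite k"
  shows "|A| \<le>o |Field k| \<longleftrightarrow> |A| \<le>o k"
proof -
  have "|Field k| =o k"
    using assms by (simp add: card_of_Field_ordIso)
  then show ?thesis
    using ordLeq_ordIso_trans ordLeq_ordIso_trans[OF _ ordIso_symmetric] by metis
qed

text \<open>The initial segment below \<open>a\<close> is smaller than \<open>k\<close> because
  \<open>k\<close> is a cardinal, and a union of three sets smaller than \<open>k\<close> stays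
  below \<open>k\<close>. Thus every tail has room for an indexing of up to \<open>k\<close> sets,
  which is how axiom (v) of small systems gets applied.\<close>

lemma card_aboveS:
  assumes "Cinfinite k" "a \<in> Field k"
  shows "k \<le>o |aboveS k a|"
proof (rule ccontr)
  assume "\<not> k \<le>o |aboveS k a|"
  have wo: "Well_order k"
    using assms(1) by (simp add: card_order_on_well_order_on)
  have "|aboveS k a| <o k"
    using \<open>\<not> k \<le>o _\<close> by (simp only: not_ordLeq_iff_ordLess[OF card_of_Well_order wo])
  moreover have "|underS k a| <o k"
    using assms by (intro card_of_underS) simp_all
  moreover have "|{a}| <o k"
    using assms(1) by (intro Cfinite_ordLess_Cinfinite)
      (auto simp: cfinite_def Field_card_of card_of_card_order_on)
  ultimately have "|aboveS k a \<union> (underS k a \<union> {a})| <o k"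
    using assms(1) by (intro Un_Cinfinite_bound_strict)
  moreover have "Field k \<subseteq> aboveS k a \<union> (underS k a \<union> {a})"
    using wo assms(2) unfolding aboveS_def underS_def order_on_defs total_on_def by auto
  ultimately have "|Field k| <o k"
    by (rule ordLeq_ordLess_trans[OF card_of_mono1, rotated])
  then show False
    using assms(1) card_of_Field_ordIso not_ordLess_ordIso by blast
qed

text \<open>This is (2^k)^k = 2^k: a nonempty small subset of \<open>Y\<close>, with its elements
  coded as subsets of \<open>Field k\<close>, is listed by the rows of a binary relation on
  \<open>Field k\<close>.\<close>

lemma card_small_subsets:
  assumes k: "Cinfinite k" and Y: "|Y| \<le>o |Pow (Field k)|"
  shows "|{s. s \<subseteq> Y \<and> |s| \<le>o k}| \<le>o |Pow (Field k)|"
proof -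
  let ?K = "Field k"
  have inf: "infinite ?K"
    using k by (simp add: cinfinite_def)
  obtain h where h: "inj_on h Y" "h ` Y \<subseteq> Pow ?K"
    using Y unfolding card_of_ordLeq[symmetric] by blast
  \<comment> \<open>\<open>D\<close> decodes a relation: it collects the elements of
    \<open>Y\<close> whose code occurs as a row.\<close>
  define D where "D R = {y \<in> Y. \<exists>a\<in>?K. h y = {b. (a, b) \<in> R}}" for R
  \<comment> \<open>The empty set is added by hand: rows are indexed by all of
    \<open>Field k\<close>, so an enumeration by rows exists only for nonempty sets.\<close>
  have "{s. s \<subseteq> Y \<and> |s| \<le>o k} \<subseteq> D ` Pow (?K \<times> ?K) \<union> {{}}"
  proof clarsimp
    fix s assume s: "s \<subseteq> Y" "|s| \<le>o k" "s \<notin> D ` Pow (?K \<times> ?K)"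
    show "s = {}"
    proof (rule ccontr)
      assume "s \<noteq> {}"
      moreover have "|s| \<le>o |?K|"
        using s(2) k by (simp add: ordLeq_card_Field_iff)
      ultimately obtain g where g: "g ` ?K = s"
        using card_of_ordLeq2 by metis
      define R where "R = {(a, b). a \<in> ?K \<and> b \<in> h (g a)}"
      have row: "{b. (a, b) \<in> R} = h (g a)" if "a \<in> ?K" for a
        using that by (auto simp: R_def)
      have "D R = {y \<in> Y. \<exists>a\<in>?K. h y = h (g a)}"
        unfolding D_def using row by auto
      also have "\<dots> = s"
        using g s(1) inj_onD[OF h(1)] by blast
      finally have "D R = s" .
      moreover have "R \<subseteq> ?K \<times> ?K"
        using h(2) g s(1) by (auto simp: R_def)
      ultimately show False
        using s(3) by blast
    qed
  qed
  moreover have "|D ` Pow (?K \<times> ?K) \<union> {{}}| \<le>o |Pow ?K|"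
  proof (rule card_of_Un_ordLeq_infinite_Field)
    have "|?K \<times> ?K| =o |?K|"
      using inf by (rule card_of_Times_same_infinite)
    then show "|D ` Pow (?K \<times> ?K)| \<le>o |Pow ?K|"
      by (intro ordLeq_ordIso_trans[OF card_of_image] card_of_Pow_cong)
    show "|{{}}| \<le>o |Pow ?K|"
      by (intro card_of_singl_ordLeq) auto
  qed (use inf in \<open>auto simp: Field_card_of card_of_card_order_on\<close>)
  ultimately show ?thesis
    by (rule ordLeq_transitive[OF card_of_mono1])
qed

text \<open>\<open>GCH\<close> speaks of sets over the type of \<open>X\<close>, whereas
  \<open>Field k\<close> lives in another type. Since \<open>X\<close> has size k^+, it contains a
  copy \<open>A\<close> of \<open>Field k\<close>, and the hypothesis is applied to that
  copy.\<close>

lemma card_Pow_eq_cardSuc: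
  assumes gch: "GCH TYPE('a)" and k: "Cinfinite k" and X: "|X :: 'a set| =o cardSuc k"
  shows "|Pow (Field k)| =o |X|"
proof -
  have Kk: "|Field k| =o k"
    using k card_of_Field_ordIso by blast
  have "k \<le>o |X|"
    by (rule ordLeq_ordIso_trans[OF cardSuc_ordLeq ordIso_symmetric[OF X]]) (use k in simp)
  then have "|Field k| \<le>o |X|"
    by (rule ordIso_ordLeq_trans[OF Kk])
  then obtain h where h: "inj_on h (Field k)" "h ` Field k \<subseteq> X"
    unfolding card_of_ordLeq[symmetric] by blast
  define A where "A = h ` Field k"
  have KA: "|Field k| =o |A|"
    using h(1) unfolding A_def by (metis card_of_ordIso inj_on_imp_bij_betw)
  have "infinite A"
    using h(1) k unfolding A_def cinfinite_def by (simp add: finite_image_iff)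
  then have "|Pow A| =o cardSuc |A|"
    using gch unfolding GCH_def by blast
  moreover have "cardSuc |A| =o cardSuc k"
    by (rule cardSuc_invar_ordIso[THEN iffD2, OF card_of_Card_order _
          ordIso_transitive[OF ordIso_symmetric[OF KA] Kk]]) (use k in simp)
  moreover have "|Pow (Field k)| =o |Pow A|"
    using KA by (rule card_of_Pow_cong)
  ultimately show ?thesis
    using ordIso_symmetric[OF X] by (blast intro: ordIso_transitive)
qed

section \<open>Independent families and Ulam matrices\<close>

text \<open>\<open>(s, T)\<close> belongs to the Hausdorff set with label \<open>B \<subseteq> X\<close> iff \<open>s \<inter> B \<in> T\<close>.\<close>

definition trace_pairs :: "'k rel \<Rightarrow> 'a set \<Rightarrow> ('a set \<times> 'a set set) set" where
  "trace_pairs k X = {(s, T). s \<subseteq> X \<and> |s| \<le>o k \<and> T \<subseteq> Pow s \<and> |T| \<le>o k}"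

text \<open>Both coordinates are small sets: \<open>s\<close> is a small subset of \<open>X\<close>,
  and \<open>T\<close> is a small family of such subsets. Two uses of
  \<open>card_small_subsets\<close> bound the number of pairs by 2^k * 2^k = 2^k.\<close>

lemma card_trace_pairs:
  assumes k: "Cinfinite k" and X: "|X| \<le>o |Pow (Field k)|"
  shows "|trace_pairs k X| \<le>o |Pow (Field k)|"
proof -
  let ?Y = "{s. s \<subseteq> X \<and> |s| \<le>o k}"
  have Y: "|?Y| \<le>o |Pow (Field k)|"
    using assms by (rule card_small_subsets)
  have "trace_pairs k X \<subseteq> ?Y \<times> {T. T \<subseteq> ?Y \<and> |T| \<le>o k}"
  proof (rule subrelI)
    fix s T assume "(s, T) \<in> trace_pairs k X"
    then have *: "s \<subseteq> X" "|s| \<le>o k" "T \<subseteq> Pow s" "|T| \<le>o k"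
      by (auto simp: trace_pairs_def)
    have "|t| \<le>o k" if "t \<in> T" for t
      using that *(3) by (intro ordLeq_transitive[OF card_of_mono1 *(2)]) blast
    then show "(s, T) \<in> ?Y \<times> {T. T \<subseteq> ?Y \<and> |T| \<le>o k}"
      using * by blast
  qed
  moreover have "|?Y \<times> {T. T \<subseteq> ?Y \<and> |T| \<le>o k}| \<le>o |Pow (Field k)|"
    using k Y card_small_subsets[OF k Y]
    by (intro card_of_Times_ordLeq_infinite_Field)
      (auto simp: Field_card_of card_of_card_order_on cinfinite_def)
  ultimately show ?thesis
    by (rule ordLeq_transitive[OF card_of_mono1])
qed

text \<open>Combinatorial core of Hausdorff's construction. One point from the symmetric difference
  of each two labels in \<open>J\<close> makes at most \<open>k\<close> points, and on this set
  \<open>s\<close> distinct labels leave distinct traces. Then \<open>T\<close> can list exactly the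
  traces of \<open>J'\<close>.\<close>

lemma trace_pairs_separate:
  fixes X :: "'a set"
  assumes k: "Cinfinite k" and J: "J \<subseteq> Pow X" "|J| \<le>o k" "J' \<subseteq> J"
  shows "\<exists>(s, T) \<in> trace_pairs k X. \<forall>B\<in>J. s \<inter> B \<in> T \<longleftrightarrow> B \<in> J'"
proof -
  define d :: "'a set \<times> 'a set \<Rightarrow> 'a" where "d = (\<lambda>(B, C). SOME x. x \<in> sym_diff B C)"
  have d: "d (B, C) \<in> sym_diff B C" if "B \<noteq> C" for B C :: "'a set"
  proof -
    have "\<exists>x. x \<in> sym_diff B C"
      using that by blast
    then show ?thesis
      unfolding d_def prod.case by (rule someI_ex)
  qed
  \<comment> \<open>On the diagonal \<open>d\<close> is an unspecified point; the intersection with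
    \<open>X\<close> keeps it from leading out of \<open>X\<close>.\<close>
  define s where "s = d ` (J \<times> J) \<inter> X"
  have small: "|s| \<le>o k"
  proof -
    have "|J \<times> J| \<le>o k"
      using k J(2) by (intro card_of_Times_ordLeq_infinite_Field) (auto simp: cinfinite_def)
    then show ?thesis
      unfolding s_def
      by (rule ordLeq_transitive[OF card_of_mono1[OF Int_lower1] ordLeq_transitive[OF card_of_image]])
  qed
  have sep: "B = C" if "B \<in> J" "C \<in> J" "s \<inter> B = s \<inter> C" for B C
  proof (rule ccontr)
    assume "B \<noteq> C"
    then have "d (B, C) \<in> sym_diff B C"
      by (rule d)
    moreover have "d (B, C) \<in> s"
      using that J(1) \<open>d (B, C) \<in> sym_diff B C\<close> unfolding s_def by blast
    ultimately show False
      using that(3) by blast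
  qed
  define T where "T = (\<lambda>B. s \<inter> B) ` J'"
  have "|T| \<le>o k"
    unfolding T_def
    by (rule ordLeq_transitive[OF card_of_image ordLeq_transitive[OF card_of_mono1[OF J(3)] J(2)]])
  then have "(s, T) \<in> trace_pairs k X"
    using small by (auto simp: trace_pairs_def T_def s_def)
  moreover have "\<forall>B\<in>J. s \<inter> B \<in> T \<longleftrightarrow> B \<in> J'"
    unfolding T_def using sep J(3) by blast
  ultimately show ?thesis
    by blast
qed

text \<open>Well-order \<open>X\<close> in type k^+, so that each \<open>x\<close> has at most
  \<open>k\<close> predecessors, and let \<open>f x\<close> inject them into \<open>Field k\<close>.
  Put \<open>x\<close> into \<open>M \<xi> \<eta>\<close> when \<eta> precedes \<open>x\<close> and
  has code \<xi>. Injectivity of \<open>f x\<close> makes rows disjoint; column \<eta> misses only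
  \<eta> and its predecessors.\<close>

lemma ulam_matrix:
  assumes k: "Cinfinite k" and X: "|X| =o cardSuc k"
  shows "\<exists>M :: 'k \<Rightarrow> 'a \<Rightarrow> 'a set. (\<forall>\<xi>. disjoint_family_on (M \<xi>) X) \<and>
    (\<forall>\<xi> \<eta>. M \<xi> \<eta> \<subseteq> X) \<and> (\<forall>\<eta>\<in>X. |X - (\<Union>\<xi>\<in>Field k. M \<xi> \<eta>)| \<le>o k)"
proof -
  define r where "r = |X|"
  have r: "Well_order r" "Card_order r" "Field r = X" "r =o cardSuc k"
    unfolding r_def by (rule card_of_Well_order card_of_Card_order Field_card_of X)+
  have below: "|underS r x| \<le>o k" if "x \<in> X" for x
    using that k X r card_of_underS[of r x] unfolding r_def
    by (intro ordLeq_if_ordLess_cardSuc) auto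
  have "\<exists>f. inj_on f (underS r x) \<and> f ` underS r x \<subseteq> Field k" if "x \<in> X" for x
  proof -
    have "|underS r x| \<le>o |Field k|"
      using below[OF that] k by (simp add: ordLeq_card_Field_iff)
    then show ?thesis
      unfolding card_of_ordLeq[symmetric] .
  qed
  then obtain f where f: "\<And>x. x \<in> X \<Longrightarrow> inj_on (f x) (underS r x)"
      "\<And>x. x \<in> X \<Longrightarrow> f x ` underS r x \<subseteq> Field k"
    by metis
  define M where "M \<xi> \<eta> = {x \<in> X. \<eta> \<in> underS r x \<and> f x \<eta> = \<xi>}" for \<xi> \<eta>
  have "disjoint_family_on (M \<xi>) X" for \<xi>
    unfolding disjoint_family_on_def M_def using f(1) by (auto dest: inj_onD)
  moreover have "|X - (\<Union>\<xi>\<in>Field k. M \<xi> \<eta>)| \<le>o k" if "\<eta> \<in> X" for \<eta>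
  proof -
    have "x \<in> underS r \<eta> \<union> {\<eta>}" if x: "x \<in> X" "x \<notin> (\<Union>\<xi>\<in>Field k. M \<xi> \<eta>)" for x
    proof (rule ccontr)
      assume "x \<notin> underS r \<eta> \<union> {\<eta>}"
      moreover have "total_on X r"
        using r(1,3) by (simp add: order_on_defs)
      ultimately have "\<eta> \<in> underS r x"
        using x(1) \<open>\<eta> \<in> X\<close> unfolding underS_def total_on_def by auto
      moreover from this have "f x \<eta> \<in> Field k"
        using f(2)[OF x(1)] by blast
      ultimately show False
        using x unfolding M_def by blast
    qed
    then have "X - (\<Union>\<xi>\<in>Field k. M \<xi> \<eta>) \<subseteq> underS r \<eta> \<union> {\<eta>}"
      by blast
    moreover have "|underS r \<eta> \<union> {\<eta>}| \<le>o k"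
      using k below[OF that]
      by (intro Un_Cinfinite_bound)
        (auto intro!: ordLess_imp_ordLeq Cfinite_ordLess_Cinfinite
          simp: cfinite_def Field_card_of card_of_card_order_on)
    ultimately show ?thesis
      by (rule ordLeq_transitive[OF card_of_mono1])
  qed
  ultimately show ?thesis
    by (intro exI[of _ M]) (auto simp: M_def)
qed

section \<open>Generated algebras\<close>

lemma k_algebra_Pow:
  assumes "transformation_space X G"
  shows "k_algebra k X G (Pow X)"
proof -
  have "g ` E \<subseteq> X" if "g \<in> G" "E \<subseteq> X" for g E
  proof -
    have "G \<subseteq> Bij X"
      using assms subgroup.subset unfolding transformation_space_def BijGroup_def by fastforce
    then show ?thesis
      using that Bij_imp_funcset[of g X] by blast
  qed
  then show ?thesis
    unfolding k_algebra_def k_additive_def invariant_class_def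
    by (auto simp: algebra_Pow)
qed

lemma k_algebra_Inter:
  assumes "T \<noteq> {}" and T: "\<And>\<A>. \<A> \<in> T \<Longrightarrow> k_algebra k X G \<A>"
  shows "k_algebra k X G (\<Inter>T)"
proof -
  have "algebra X (\<Inter>T)"
    using assms unfolding k_algebra_def algebra_iff_Un by blast
  \<comment> \<open>The empty set witnesses that the intersection is a nonempty class, as
    \<open>invariant_class\<close> demands.\<close>
  moreover have "{} \<in> \<Inter>T"
    using T unfolding k_algebra_def algebra_iff_Un by blast
  moreover have "k_additive k (\<Inter>T)"
    using T unfolding k_algebra_def k_additive_def by (meson Inter_iff le_Inf_iff)
  moreover have "\<Inter>T \<subseteq> Pow X"
    using assms unfolding k_algebra_def invariant_class_def by blast
  moreover have "\<forall>g\<in>G. \<forall>E\<in>\<Inter>T. g ` E \<in> \<Inter>T"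
    using T unfolding k_algebra_def invariant_class_def by blast
  ultimately show ?thesis
    unfolding k_algebra_def invariant_class_def by blast
qed

text \<open>The hull is an intersection of algebras as soon as one algebra contains the generators;
  \<open>Pow X\<close> is such an algebra.\<close>

lemma k_algebra_hull:
  assumes "transformation_space X G" and "\<A> \<subseteq> Pow X"
  shows "k_algebra k X G (k_algebra k X G hull \<A>)"
  unfolding hull_def
proof (rule k_algebra_Inter)
  show "{t. k_algebra k X G t \<and> \<A> \<subseteq> t} \<noteq> {}"
    using k_algebra_Pow[OF assms(1)] assms(2) by blast
qed simp

section \<open>Small systems\<close>

lemma small_systemD:
  assumes "small_system k X G N" and \<alpha>: "\<alpha> \<in> Field k"
  shows "{} \<in> N \<alpha>" and "invariant_class X G (N \<alpha>)"
    and "E \<in> N \<alpha> \<Longrightarrow> F \<subseteq> E \<Longrightarrow> F \<in> N \<alpha>"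
    and "\<exists>\<alpha>'\<in>aboveS k \<alpha>. \<forall>E. (\<forall>\<beta>\<in>aboveS k \<alpha>'. E \<beta> \<in> N \<beta>) \<longrightarrow>
      (\<Union>\<beta>\<in>aboveS k \<alpha>'. E \<beta>) \<in> N \<alpha>"
    and "\<beta> \<in> Field k \<Longrightarrow> \<exists>\<gamma>\<in>Field k. N \<gamma> \<subseteq> N \<alpha> \<and> N \<gamma> \<subseteq> N \<beta>"
proof -
  note N = assms(1)[unfolded small_system_def]
  show "{} \<in> N \<alpha>"
    using N \<alpha> by simp
  show "invariant_class X G (N \<alpha>)"
    using N \<alpha> by simp
  show "E \<in> N \<alpha> \<Longrightarrow> F \<subseteq> E \<Longrightarrow> F \<in> N \<alpha>"
    using conjunct1[OF conjunct2[OF conjunct2[OF N]]] \<alpha> by blast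
  show "\<exists>\<alpha>'\<in>aboveS k \<alpha>. \<forall>E. (\<forall>\<beta>\<in>aboveS k \<alpha>'. E \<beta> \<in> N \<beta>) \<longrightarrow>
      (\<Union>\<beta>\<in>aboveS k \<alpha>'. E \<beta>) \<in> N \<alpha>"
    using N \<alpha> by (elim conjE) (rule bspec)
  assume "\<beta> \<in> Field k"
  then have "\<exists>\<gamma>\<in>aboveS k \<alpha> \<inter> aboveS k \<beta>. N \<gamma> \<subseteq> N \<alpha> \<and> N \<gamma> \<subseteq> N \<beta>"
    using N \<alpha> by (elim conjE) (drule bspec, assumption)+
  then show "\<exists>\<gamma>\<in>Field k. N \<gamma> \<subseteq> N \<alpha> \<and> N \<gamma> \<subseteq> N \<beta>"
    unfolding aboveS_def by (blast intro: FieldI2)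
qed

text \<open>Axiom (v) is used with only two nonempty terms, at distinct indices \<beta>1 and
  \<beta>2 of a tail; axiom (vi) then gives one class contained in both of theirs.\<close>

lemma small_system_halving:
  assumes k: "Cinfinite k" and N: "small_system k X G N" and \<alpha>: "\<alpha> \<in> Field k"
  shows "\<exists>\<gamma>\<in>Field k. \<forall>E\<in>N \<gamma>. \<forall>F\<in>N \<gamma>. E \<union> F \<in> N \<alpha>"
proof -
  obtain \<alpha>' where \<alpha>': "\<alpha>' \<in> aboveS k \<alpha>"
    "\<And>E. (\<forall>\<beta>\<in>aboveS k \<alpha>'. E \<beta> \<in> N \<beta>) \<Longrightarrow> (\<Union>\<beta>\<in>aboveS k \<alpha>'. E \<beta>) \<in> N \<alpha>"
    using small_systemD(4)[OF N \<alpha>] by blast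
  have sub: "aboveS k \<alpha>' \<subseteq> Field k"
    by (auto simp: aboveS_def intro: FieldI2)
  have "\<alpha>' \<in> Field k"
    using \<alpha>'(1) by (auto simp: aboveS_def intro: FieldI2)
  then have "k \<le>o |aboveS k \<alpha>'|"
    by (rule card_aboveS[OF k])
  then have "infinite (aboveS k \<alpha>')"
    using k by (metis Field_card_of cinfinite_def cinfinite_mono)
  then obtain \<beta>1 where 1: "\<beta>1 \<in> aboveS k \<alpha>'"
    by fastforce
  have "infinite (aboveS k \<alpha>' - {\<beta>1})"
    using \<open>infinite _\<close> by simp
  then obtain \<beta>2 where 2: "\<beta>2 \<in> aboveS k \<alpha>'" "\<beta>2 \<noteq> \<beta>1"
    by (metis Diff_iff finite.emptyI insertI1 ex_in_conv)
  obtain \<gamma> where \<gamma>: "\<gamma> \<in> Field k" "N \<gamma> \<subseteq> N \<beta>1" "N \<gamma> \<subseteq> N \<beta>2"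
    using small_systemD(5)[OF N, of \<beta>1 \<beta>2] 1 2 sub by blast
  have "E \<union> F \<in> N \<alpha>" if "E \<in> N \<gamma>" "F \<in> N \<gamma>" for E F
  proof -
    \<comment> \<open>All remaining terms are empty, which axiom (i) allows.\<close>
    define H where "H \<beta> = (if \<beta> = \<beta>1 then E else if \<beta> = \<beta>2 then F else {})" for \<beta>
    have "(\<Union>\<beta>\<in>aboveS k \<alpha>'. H \<beta>) \<in> N \<alpha>"
      using that \<gamma> sub small_systemD(1)[OF N] by (intro \<alpha>'(2)) (auto simp: H_def)
    moreover have "(\<Union>\<beta>\<in>aboveS k \<alpha>'. H \<beta>) = E \<union> F"
      using 1 2 by (auto simp: H_def split: if_splits)
    ultimately show ?thesis
      by simp
  qed
  then show ?thesis
    using \<gamma>(1) by blast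
qed

text \<open>For additivity, at most \<open>k\<close> members are enumerated, with repetitions, along
  a tail of \<open>k\<close>. Each lies in every class, so axiom (v) puts the union into the given
  \<open>N \<alpha>\<close>. Binary unions are a special case.\<close>

lemma k_ideal_N_infinity:
  assumes k: "Cinfinite k" and N: "small_system k X G N"
  shows "k_ideal k X G (N_infinity k N)"
proof -
  note small = small_systemD[OF N]
  obtain \<alpha>\<^sub>0 where \<alpha>\<^sub>0: "\<alpha>\<^sub>0 \<in> Field k"
    using k by (metis cinfinite_def ex_in_conv finite.emptyI)
  have additive: "k_additive k (N_infinity k N)"
    unfolding k_additive_def
  proof (intro allI impI, elim conjE)
    fix \<C> assume \<C>: "\<C> \<subseteq> N_infinity k N" "|\<C>| \<le>o k"
    have "\<Union>\<C> \<in> N \<alpha>" if \<alpha>: "\<alpha> \<in> Field k" for \<alpha>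
    proof (cases "\<C> = {}")
      case True
      then show ?thesis
        using small(1)[OF \<alpha>] by simp
    next
      case False
      obtain \<alpha>' where \<alpha>': "\<alpha>' \<in> aboveS k \<alpha>"
        "\<And>E. (\<forall>\<beta>\<in>aboveS k \<alpha>'. E \<beta> \<in> N \<beta>) \<Longrightarrow> (\<Union>\<beta>\<in>aboveS k \<alpha>'. E \<beta>) \<in> N \<alpha>"
        using small(4)[OF \<alpha>] by blast
      have "\<alpha>' \<in> Field k"
        using \<alpha>'(1) by (auto simp: aboveS_def intro: FieldI2)
      then have "|\<C>| \<le>o |aboveS k \<alpha>'|"
        by (rule ordLeq_transitive[OF \<C>(2) card_aboveS[OF k]])
      then obtain g where g: "g ` aboveS k \<alpha>' = \<C>"
        unfolding card_of_ordLeq2[OF False, symmetric] by blast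
      have "(\<Union>\<beta>\<in>aboveS k \<alpha>'. g \<beta>) \<in> N \<alpha>"
        using g \<C>(1) by (intro \<alpha>'(2)) (auto simp: N_infinity_def aboveS_def intro: FieldI2)
      then show ?thesis
        using g by simp
    qed
    then show "\<Union>\<C> \<in> N_infinity k N"
      by (simp add: N_infinity_def)
  qed
  have "E \<union> F \<in> N_infinity k N" if "E \<in> N_infinity k N" "F \<in> N_infinity k N" for E F
  proof -
    have "|{E, F}| \<le>o k"
      using k by (intro ordLess_imp_ordLeq Cfinite_ordLess_Cinfinite)
        (auto simp: cfinite_def Field_card_of card_of_card_order_on)
    then have "\<Union>{E, F} \<in> N_infinity k N"
      using additive[unfolded k_additive_def, rule_format, of "{E, F}"] that by simp
    then show ?thesis
      by simp
  qed
  then have "\<forall>E\<in>N_infinity k N. \<forall>F\<in>N_infinity k N. E \<union> F \<in> N_infinity k N"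
    by simp
  moreover have "N_infinity k N \<noteq> {}"
    using small(1) by (auto simp: N_infinity_def)
  moreover have "N_infinity k N \<subseteq> Pow X"
    using small(2)[OF \<alpha>\<^sub>0] \<alpha>\<^sub>0 by (auto simp: invariant_class_def N_infinity_def)
  moreover have "\<forall>E\<in>N_infinity k N. \<forall>F. F \<subseteq> E \<longrightarrow> F \<in> N_infinity k N"
    using small(3) unfolding N_infinity_def by blast
  moreover have "\<forall>g\<in>G. \<forall>E\<in>N_infinity k N. g ` E \<in> N_infinity k N"
    using small(2) by (auto simp: invariant_class_def N_infinity_def)
  ultimately show ?thesis
    using additive unfolding k_ideal_def set_ideal_def invariant_class_def by (intro conjI)
qed

text \<open>The uniformity consists of all supersets of entourages inside the square. Axiom (vi)
  handles intersections, while composition combines halving with the triangle inclusion for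
  symmetric differences. No closure property of the family of points enters.\<close>

lemma entourage_base:
  assumes k: "Cinfinite k" and N: "small_system k X G N"
  shows "\<exists>\<U>. is_uniformity \<S> \<U> \<and> uniformity_base (entourage \<S> N ` Field k) \<U>"
proof -
  note small = small_systemD[OF N]
  define \<U> where "\<U> = {V. V \<subseteq> \<S> \<times> \<S> \<and> (\<exists>\<alpha>\<in>Field k. entourage \<S> N \<alpha> \<subseteq> V)}"
  have ent: "entourage \<S> N \<alpha> \<in> \<U>" if "\<alpha> \<in> Field k" for \<alpha>
    using that unfolding \<U>_def entourage_def by blast
  obtain \<alpha>\<^sub>0 where "\<alpha>\<^sub>0 \<in> Field k"
    using k by (metis cinfinite_def ex_in_conv finite.emptyI)
  then have "\<U> \<noteq> {}"
    using ent by blast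
  have "is_uniformity \<S> \<U>"
    unfolding is_uniformity_def
  proof (intro conjI ballI allI impI; (elim conjE)?)
    show "\<U> \<noteq> {}"
      by fact
  next
    fix U assume U: "U \<in> \<U>"
    have "Id_on \<S> \<subseteq> entourage \<S> N \<alpha>" if "\<alpha> \<in> Field k" for \<alpha>
      using small(1)[OF that] unfolding entourage_def by auto
    then show "Id_on \<S> \<subseteq> U" "U \<subseteq> \<S> \<times> \<S>"
      using U unfolding \<U>_def by blast+
  next
    fix U V assume "U \<in> \<U>" "U \<subseteq> V" "V \<subseteq> \<S> \<times> \<S>"
    then show "V \<in> \<U>"
      unfolding \<U>_def by blast
  next
    fix U V assume UV: "U \<in> \<U>" "V \<in> \<U>"
    obtain \<alpha> \<beta> where ab: "\<alpha> \<in> Field k" "entourage \<S> N \<alpha> \<subseteq> U" "\<beta> \<in> Field k" "entourage \<S> N \<beta> \<subseteq> V"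
      using UV unfolding \<U>_def by blast
    obtain \<gamma> where "\<gamma> \<in> Field k" "N \<gamma> \<subseteq> N \<alpha>" "N \<gamma> \<subseteq> N \<beta>"
      using small(5) ab(1,3) by blast
    then have "entourage \<S> N \<gamma> \<subseteq> U \<inter> V"
      using ab(2,4) unfolding entourage_def by blast
    then show "U \<inter> V \<in> \<U>"
      using UV \<open>\<gamma> \<in> Field k\<close> unfolding \<U>_def by blast
  next
    fix U assume U: "U \<in> \<U>"
    have "(entourage \<S> N \<alpha>)\<inverse> = entourage \<S> N \<alpha>" for \<alpha>
      unfolding entourage_def by (auto simp: Un_commute)
    then have "entourage \<S> N \<alpha> \<subseteq> U\<inverse>" if "entourage \<S> N \<alpha> \<subseteq> U" for \<alpha>
      using that converse_mono by metis
    then show "U\<inverse> \<in> \<U>"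
      using U unfolding \<U>_def by blast
  next
    fix U assume U: "U \<in> \<U>"
    obtain \<alpha> where \<alpha>: "\<alpha> \<in> Field k" "entourage \<S> N \<alpha> \<subseteq> U"
      using U unfolding \<U>_def by blast
    obtain \<gamma> where \<gamma>: "\<gamma> \<in> Field k" "\<forall>E\<in>N \<gamma>. \<forall>F\<in>N \<gamma>. E \<union> F \<in> N \<alpha>"
      using small_system_halving[OF k N \<alpha>(1)] by blast
    have "(E, H) \<in> entourage \<S> N \<alpha>" if "(E, F) \<in> entourage \<S> N \<gamma>" "(F, H) \<in> entourage \<S> N \<gamma>" for E F H
    proof -
      have "sym_diff E F \<union> sym_diff F H \<in> N \<alpha>"
        using that \<gamma>(2) unfolding entourage_def by blast
      moreover have "sym_diff E H \<subseteq> sym_diff E F \<union> sym_diff F H"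
        by blast
      ultimately have "sym_diff E H \<in> N \<alpha>"
        using small(3)[OF \<alpha>(1)] by blast
      then show ?thesis
        using that unfolding entourage_def by blast
    qed
    then have "entourage \<S> N \<gamma> O entourage \<S> N \<gamma> \<subseteq> U"
      using \<alpha>(2) by blast
    then show "\<exists>V\<in>\<U>. V O V \<subseteq> U"
      using ent[OF \<gamma>(1)] by blast
  qed
  moreover have "uniformity_base (entourage \<S> N ` Field k) \<U>"
    using ent unfolding uniformity_base_def \<U>_def by blast
  ultimately show ?thesis
    by blast
qed

section \<open>Many disjoint sets outside one small class\<close>

text \<open>By transitivity and invariance, a class \<open>N \<alpha>\<close> that misses one
  singleton misses all of them. Being diffused, \<open>S\<close> would then contain k^+ disjoint
  sets outside \<open>N \<alpha>\<close>, against admissibility.\<close>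

lemma singleton_in_N_infinity:
  assumes k: "Cinfinite k" and X: "|X| =o cardSuc k"
    and trans: "acts_transitively X G" and diff: "diffused X S"
    and N: "small_system k X G N" and adm: "admissible k S N" and x: "x \<in> X"
  shows "{x} \<in> N_infinity k N"
proof -
  have "{x} \<in> N \<alpha>" if \<alpha>: "\<alpha> \<in> Field k" for \<alpha>
  proof (rule ccontr)
    assume "{x} \<notin> N \<alpha>"
    have "{y} \<notin> N \<alpha>" if "y \<in> X" for y
    proof
      assume "{y} \<in> N \<alpha>"
      have "x \<in> {g y | g. g \<in> G}"
        using trans \<open>y \<in> X\<close> x by (simp add: acts_transitively_def)
      then obtain g where "g \<in> G" "g y = x"
        by blast
      then have "{x} \<in> N \<alpha>"
        using \<open>{y} \<in> N \<alpha>\<close> small_systemD(2)[OF N \<alpha>] unfolding invariant_class_def by fastforce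
      then show False
        using \<open>{x} \<notin> N \<alpha>\<close> by blast
    qed
    then have "(\<lambda>y. {y}) ` X \<subseteq> S - N \<alpha>"
      using diff unfolding diffused_def by blast
    moreover have "disjoint ((\<lambda>y. {y}) ` X)"
      by (auto simp: disjoint_def)
    ultimately have "|(\<lambda>y. {y}) ` X| \<le>o k"
      using adm \<alpha> unfolding admissible_def by blast
    moreover have "|X| \<le>o |(\<lambda>y. {y}) ` X|"
      unfolding card_of_ordLeq[symmetric] by (intro exI[of _ "\<lambda>y. {y}"]) auto
    ultimately show False
      using not_ordLeq_if_ordIso_cardSuc[OF k X] by (blast dest: ordLeq_transitive)
  qed
  then show ?thesis
    by (simp add: N_infinity_def)
qed

text \<open>Each column of the Ulam matrix has an entry outside some class, since otherwise the
  column and its small complement would put \<open>X\<close> into the ideal. Columns are then sorted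
  by row and class of such an entry, and the entries in one row are disjoint.\<close>

lemma disjoint_positive_family:
  fixes k :: "'k rel" and X :: "'a set"
  assumes k: "Cinfinite k" and X: "|X| =o cardSuc k" and N: "small_system k X G N"
    and single: "\<And>x. x \<in> X \<Longrightarrow> {x} \<in> N_infinity k N" and proper: "X \<notin> N_infinity k N"
  shows "\<exists>\<alpha>\<in>Field k. \<exists>(H :: 'a set) U. |X| \<le>o |H| \<and> disjoint_family_on U H \<and>
    (\<forall>\<eta>\<in>H. U \<eta> \<subseteq> X \<and> U \<eta> \<notin> N \<alpha>)"
proof -
  obtain M :: "'k \<Rightarrow> 'a \<Rightarrow> 'a set" where M: "\<And>\<xi>. disjoint_family_on (M \<xi>) X" "\<And>\<xi> \<eta>. M \<xi> \<eta> \<subseteq> X"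
      "\<And>\<eta>. \<eta> \<in> X \<Longrightarrow> |X - (\<Union>\<xi>\<in>Field k. M \<xi> \<eta>)| \<le>o k"
    using ulam_matrix[OF k X] by blast
  have ideal: "k_ideal k X G (N_infinity k N)"
    using k N by (rule k_ideal_N_infinity)
  have additive: "\<Union>\<C> \<in> N_infinity k N" if "\<C> \<subseteq> N_infinity k N" "|\<C>| \<le>o k" for \<C>
    using ideal that unfolding k_ideal_def k_additive_def by blast
  have small: "Y \<in> N_infinity k N" if "Y \<subseteq> X" "|Y| \<le>o k" for Y
  proof -
    have "\<Union>((\<lambda>y. {y}) ` Y) \<in> N_infinity k N"
    proof (rule additive)
      show "(\<lambda>y. {y}) ` Y \<subseteq> N_infinity k N"
        using single that(1) by blast
      show "|(\<lambda>y. {y}) ` Y| \<le>o k"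
        by (rule ordLeq_transitive[OF card_of_image that(2)])
    qed
    then show ?thesis
      by simp
  qed
  \<comment> \<open>The pair \<open>p\<close> records the row of the entry and the index of a class
    that misses it.\<close>
  have "\<exists>p \<in> Field k \<times> Field k. M (fst p) \<eta> \<notin> N (snd p)" if \<eta>: "\<eta> \<in> X" for \<eta>
  proof (rule ccontr)
    assume "\<not> ?thesis"
    then have "(\<lambda>\<xi>. M \<xi> \<eta>) ` Field k \<subseteq> N_infinity k N"
      unfolding N_infinity_def by fastforce
    moreover have "|(\<lambda>\<xi>. M \<xi> \<eta>) ` Field k| \<le>o k"
      by (rule ordLeq_ordIso_trans[OF card_of_image card_of_Field_ordIso]) (use k in simp)
    ultimately have "(\<Union>\<xi>\<in>Field k. M \<xi> \<eta>) \<in> N_infinity k N"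
      by (rule additive)
    moreover have "X - (\<Union>\<xi>\<in>Field k. M \<xi> \<eta>) \<in> N_infinity k N"
      using M(3)[OF \<eta>] by (intro small) auto
    ultimately have "(\<Union>\<xi>\<in>Field k. M \<xi> \<eta>) \<union> (X - (\<Union>\<xi>\<in>Field k. M \<xi> \<eta>)) \<in> N_infinity k N"
      using ideal unfolding k_ideal_def set_ideal_def by blast
    moreover have "(\<Union>\<xi>\<in>Field k. M \<xi> \<eta>) \<union> (X - (\<Union>\<xi>\<in>Field k. M \<xi> \<eta>)) = X"
      using M(2) by blast
    ultimately show False
      using proper by simp
  qed
  then obtain c where c: "\<And>\<eta>. \<eta> \<in> X \<Longrightarrow> c \<eta> \<in> Field k \<times> Field k"
      "\<And>\<eta>. \<eta> \<in> X \<Longrightarrow> M (fst (c \<eta>)) \<eta> \<notin> N (snd (c \<eta>))"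
    by metis
  \<comment> \<open>Pigeonhole: there are at most k * k = k pairs, so fibres of size at most
    \<open>k\<close> could not cover the k^+ columns.\<close>
  have "\<exists>p \<in> Field k \<times> Field k. \<not> |{\<eta> \<in> X. c \<eta> = p}| \<le>o k"
  proof (rule ccontr)
    assume "\<not> ?thesis"
    moreover have "|Field k \<times> Field k| \<le>o k"
      using k card_of_Field_ordIso ordIso_imp_ordLeq
      by (intro card_of_Times_ordLeq_infinite_Field) (auto simp: cinfinite_def)
    ultimately have "|\<Union>p\<in>Field k \<times> Field k. {\<eta> \<in> X. c \<eta> = p}| \<le>o k"
      using k by (intro UNION_Cinfinite_bound) auto
    moreover have "(\<Union>p\<in>Field k \<times> Field k. {\<eta> \<in> X. c \<eta> = p}) = X"
      using c(1) by blast
    ultimately show False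
      using not_ordLeq_if_ordIso_cardSuc[OF k X] by simp
  qed
  then obtain \<xi> \<alpha> where p: "\<xi> \<in> Field k" "\<alpha> \<in> Field k" "\<not> |{\<eta> \<in> X. c \<eta> = (\<xi>, \<alpha>)}| \<le>o k"
    by auto
  define H where "H = {\<eta> \<in> X. c \<eta> = (\<xi>, \<alpha>)}"
  have "|X| \<le>o |H|"
    using k X p(3) unfolding H_def by (rule ordLeq_if_not_ordLeq_cardSuc)
  moreover have "disjoint_family_on (M \<xi>) H"
    using M(1)[of \<xi>] by (rule disjoint_family_on_mono[rotated]) (auto simp: H_def)
  moreover have "M \<xi> \<eta> \<subseteq> X \<and> M \<xi> \<eta> \<notin> N \<alpha>" if "\<eta> \<in> H" for \<eta>
    using that c(2)[of \<eta>] M(2) by (auto simp: H_def)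
  ultimately show ?thesis
    using p(2) by (intro bexI[of _ \<alpha>] exI[of _ H] exI[of _ "M \<xi>"]) simp_all
qed

text \<open>Hausdorff's family on \<open>trace_pairs k X\<close> is blown up: \<open>e\<close>
  assigns to each pair its own block \<open>U (e p)\<close>, and \<open>A B\<close> is the union of
  the blocks whose pair belongs to the set labelled \<open>B\<close>. By disjointness a block lies
  inside \<open>A B\<close> or misses it, so both claims reduce to finding one suitable pair. The
  class \<P> stands for the sets that are not small.\<close>

lemma independent_positive_family:
  assumes k: "Cinfinite k" and X: "|X| =o |Pow (Field k)|"
    and N: "{} \<notin> \<P>" "\<And>E F. E \<in> \<P> \<Longrightarrow> E \<subseteq> F \<Longrightarrow> F \<in> \<P>"
    and H: "|X| \<le>o |H|" "disjoint_family_on U H" "\<And>\<eta>. \<eta> \<in> H \<Longrightarrow> U \<eta> \<subseteq> X \<and> U \<eta> \<in> \<P>"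
  shows "\<exists>A :: 'a set \<Rightarrow> 'a set. strictly_k_independent k X (Pow X) A \<and>
    (\<forall>B\<in>Pow X. \<forall>C\<in>Pow X. B \<noteq> C \<longrightarrow> sym_diff (A B) (A C) \<in> \<P>)"
proof -
  have "|trace_pairs k X| \<le>o |X|"
    by (rule ordLeq_ordIso_trans[OF card_trace_pairs[OF k ordIso_imp_ordLeq[OF X]] ordIso_symmetric[OF X]])
  then have "|trace_pairs k X| \<le>o |H|"
    by (rule ordLeq_transitive[OF _ H(1)])
  then obtain e where e: "inj_on e (trace_pairs k X)" "e ` trace_pairs k X \<subseteq> H"
    unfolding card_of_ordLeq[symmetric] by blast
  define A where "A B = (\<Union>p \<in> {p \<in> trace_pairs k X. fst p \<inter> B \<in> snd p}. U (e p))" for B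
  have A_iff: "x \<in> A B \<longleftrightarrow> fst p \<inter> B \<in> snd p" if "p \<in> trace_pairs k X" "x \<in> U (e p)" for p x B
  proof -
    have "q = p" if "q \<in> trace_pairs k X" "x \<in> U (e q)" for q
    proof -
      have "e q = e p"
        using H(2) e(2) that \<open>p \<in> _\<close> \<open>x \<in> U (e p)\<close> unfolding disjoint_family_on_def by blast
      then show ?thesis
        using e(1) that(1) \<open>p \<in> _\<close> by (auto dest: inj_onD)
    qed
    then show ?thesis
      unfolding A_def using that by blast
  qed
  have pos: "U (e p) \<in> \<P>" if "p \<in> trace_pairs k X" for p
    using that e(2) H(3) by blast
  have "X \<inter> (\<Inter>B\<in>J. if f B then X - A B else A B) \<noteq> {}" if J: "J \<subseteq> Pow X" "|J| \<le>o k" for J f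
  proof -
    \<comment> \<open>As \<open>f\<close> marks complementation, the labels to be accepted by
      \<open>p\<close> are those where \<open>f\<close> is false.\<close>
    obtain p where p: "p \<in> trace_pairs k X" "\<And>B. B \<in> J \<Longrightarrow> fst p \<inter> B \<in> snd p \<longleftrightarrow> \<not> f B"
      using trace_pairs_separate[OF k J, of "{B \<in> J. \<not> f B}"] by fastforce
    obtain x where x: "x \<in> U (e p)"
      using pos[OF p(1)] N(1) by (metis ex_in_conv)
    moreover have "x \<in> X"
      using x p(1) e(2) H(3) by blast
    ultimately have "x \<in> X \<inter> (\<Inter>B\<in>J. if f B then X - A B else A B)"
      using A_iff[OF p(1) x] p(2) by auto
    then show ?thesis
      by blast
  qed
  moreover have "A B \<subseteq> X" for B
    unfolding A_def using e(2) H(3) by blast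
  moreover have "sym_diff (A B) (A C) \<in> \<P>" if BC: "B \<subseteq> X" "C \<subseteq> X" "B \<noteq> C" for B C
  proof -
    have "|{B, C}| \<le>o k"
      using k by (intro ordLess_imp_ordLeq Cfinite_ordLess_Cinfinite)
        (auto simp: cfinite_def Field_card_of card_of_card_order_on)
    \<comment> \<open>Accepting \<open>B\<close> and rejecting \<open>C\<close> places a whole block
      in \<open>A B\<close> and outside \<open>A C\<close>; upward closure of \<P> does the
      rest.\<close>
    then obtain p where p: "p \<in> trace_pairs k X" "fst p \<inter> B \<in> snd p" "fst p \<inter> C \<notin> snd p"
      using trace_pairs_separate[OF k, of "{B, C}" X "{B}"] BC by fastforce
    have "U (e p) \<subseteq> sym_diff (A B) (A C)"
      using A_iff[OF p(1)] p(2,3) by blast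
    then show ?thesis
      using pos[OF p(1)] N(2) by blast
  qed
  ultimately show ?thesis
    unfolding strictly_k_independent_def by (intro exI[of _ A]) auto
qed

section \<open>The extended structure\<close>

theorem theorem2p14:
  fixes k :: "'k rel" and X :: "'a set" and G :: "('a \<Rightarrow> 'a) set"
    and S S' :: "'a set set" and N :: "'k \<Rightarrow> 'a set set"
  assumes "GCH TYPE('a)"
    and "Cinfinite k"
    and "transformation_space X G"
    and "|X| =o cardSuc k"
    and "acts_freely X G"
    and "acts_transitively X G"
    and "k_algebra k X G S"
    and "diffused X S"
    and "small_system k X G N"
    and "admissible k S N"
    and S'_eq: "S' = k_algebra k X G hull (S \<union> N_infinity k N)"
  shows "\<exists>S'' (I :: 'a set set) (A :: 'a set \<Rightarrow> 'a set). \<exists>\<alpha>\<^sub>0\<in>Field k.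
      measurable_structure k X G S'' (N_infinity k N) \<and> S' \<subseteq> S'' \<and>
      |I| =o |Pow (Field (cardSuc k))| \<and>
      strictly_k_independent k X I A \<and> A ` I \<subseteq> S'' \<and>
      S'' = k_algebra k X G hull (S' \<union> A ` I) \<and>
      (\<exists>\<U>. is_uniformity S'' \<U> \<and> uniformity_base (entourage S'' N ` Field k) \<U>) \<and>
      (\<forall>i\<in>I. \<forall>j\<in>I. i \<noteq> j \<longrightarrow> (A i, A j) \<notin> entourage S'' N \<alpha>\<^sub>0)"
proof -
  note k = \<open>Cinfinite k\<close> and X = \<open>|X| =o cardSuc k\<close> and N = \<open>small_system k X G N\<close>
    and adm = \<open>admissible k S N\<close> and space = \<open>transformation_space X G\<close>
  have S: "S \<subseteq> Pow X"
    using \<open>k_algebra k X G S\<close> unfolding k_algebra_def invariant_class_def by blast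
  have ideal: "k_ideal k X G (N_infinity k N)"
    using k N by (rule k_ideal_N_infinity)
  \<comment> \<open>Admissibility supplies some \<open>E\<close> in \<open>S\<close> outside some
    \<open>N \<alpha>\<close>; were \<open>X\<close> in the ideal, its subset \<open>E\<close> would
    lie in \<open>N \<alpha>\<close>.\<close>
  have proper: "X \<notin> N_infinity k N"
  proof
    assume "X \<in> N_infinity k N"
    obtain \<alpha> E where E: "\<alpha> \<in> Field k" "E \<in> S" "E \<notin> N \<alpha>"
      using adm unfolding admissible_def by blast
    then have "X \<in> N \<alpha>" "E \<subseteq> X"
      using \<open>X \<in> N_infinity k N\<close> S by (auto simp: N_infinity_def)
    then show False
      using small_systemD(3)[OF N E(1)] E(3) by blast
  qed
  \<comment> \<open>GCH enters here: 2^k = k^+ gives enough disjoint blocks for all trace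
    pairs.\<close>
  have XP: "|X| =o |Pow (Field k)|"
    using card_Pow_eq_cardSuc[OF \<open>GCH TYPE('a)\<close> k X] ordIso_symmetric by blast
  have single: "{x} \<in> N_infinity k N" if "x \<in> X" for x
    using k X \<open>acts_transitively X G\<close> \<open>diffused X S\<close> N adm that by (rule singleton_in_N_infinity)
  have "\<exists>\<alpha>\<in>Field k. \<exists>(H :: 'a set) U. |X| \<le>o |H| \<and> disjoint_family_on U H \<and>
      (\<forall>\<eta>\<in>H. U \<eta> \<subseteq> X \<and> U \<eta> \<notin> N \<alpha>)"
    by (rule disjoint_positive_family[OF k X N _ proper]) (rule single)
  then obtain \<alpha>\<^sub>0 U and H :: "'a set" where \<alpha>\<^sub>0: "\<alpha>\<^sub>0 \<in> Field k"
      and H: "|X| \<le>o |H|" "disjoint_family_on U H" "\<And>\<eta>. \<eta> \<in> H \<Longrightarrow> U \<eta> \<subseteq> X \<and> U \<eta> \<in> - N \<alpha>\<^sub>0"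
    by auto
  have "\<exists>A :: 'a set \<Rightarrow> 'a set. strictly_k_independent k X (Pow X) A \<and>
      (\<forall>B\<in>Pow X. \<forall>C\<in>Pow X. B \<noteq> C \<longrightarrow> sym_diff (A B) (A C) \<in> - N \<alpha>\<^sub>0)"
  proof (rule independent_positive_family[OF k XP _ _ H(1,2)])
    show "{} \<notin> - N \<alpha>\<^sub>0"
      using small_systemD(1)[OF N \<alpha>\<^sub>0] by simp
    show "F \<in> - N \<alpha>\<^sub>0" if "E \<in> - N \<alpha>\<^sub>0" "E \<subseteq> F" for E F
      using small_systemD(3)[OF N \<alpha>\<^sub>0] that by blast
  qed (rule H(3))
  then obtain A :: "'a set \<Rightarrow> 'a set" where A: "strictly_k_independent k X (Pow X) A"
      "\<And>B C. B \<in> Pow X \<Longrightarrow> C \<in> Pow X \<Longrightarrow> B \<noteq> C \<Longrightarrow> sym_diff (A B) (A C) \<in> - N \<alpha>\<^sub>0"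
    by auto
  \<comment> \<open>Every subset of \<open>X\<close> serves as a label, which yields 2^(k^+)
    sets.\<close>
  define S'' where "S'' = k_algebra k X G hull (S' \<union> A ` Pow X)"
  have NX: "N_infinity k N \<subseteq> Pow X"
    using ideal unfolding k_ideal_def set_ideal_def by blast
  have S'X: "S' \<subseteq> Pow X"
    unfolding S'_eq using S NX k_algebra_Pow[OF space] by (intro hull_minimal) auto
  have AX: "A ` Pow X \<subseteq> Pow X"
    using A(1) unfolding strictly_k_independent_def by blast
  have gen: "S' \<union> A ` Pow X \<subseteq> S''"
    unfolding S''_def by (rule hull_subset)
  have "k_algebra k X G S''"
    unfolding S''_def using S'X AX by (intro k_algebra_hull[OF space]) auto
  \<comment> \<open>The ideal already lies in \<open>S'\<close>, so it stays the same, and stays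
    proper, in the larger algebra.\<close>
  moreover have "N_infinity k N \<subseteq> S''"
    using gen hull_subset[of "S \<union> N_infinity k N" "k_algebra k X G"] unfolding S'_eq by blast
  ultimately have "measurable_structure k X G S'' (N_infinity k N)"
    using ideal proper unfolding measurable_structure_def by blast
  moreover have "|Pow X| =o |Pow (Field (cardSuc k))|"
  proof (rule card_of_Pow_cong)
    show "|X| =o |Field (cardSuc k)|"
      using k by (intro ordIso_transitive[OF X] ordIso_symmetric[OF card_of_Field_ordIso])
        (simp add: cardSuc_Card_order)
  qed
  moreover have "(A B, A C) \<notin> entourage S'' N \<alpha>\<^sub>0" if "B \<in> Pow X" "C \<in> Pow X" "B \<noteq> C" for B C
    using A(2)[OF that] unfolding entourage_def by blast
  ultimately show ?thesis
    using gen A(1) \<alpha>\<^sub>0 entourage_base[OF k N, of S''] S''_def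
    by (intro exI[of _ S''] exI[of _ "Pow X"] exI[of _ A] bexI[of _ \<alpha>\<^sub>0]) auto
qed

end
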